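(* Let $m>1$ be an odd integer and let $H_m=\langle x,y \mid xyxy\cdots yx = yxyx\cdots xy\rangle$, where both words are alternating of length $m$ (the left one begins and ends with $x$, the right one begins and ends with $y$). Then, in the coordinates $X=\tau_x$ and $Z=\tau_{xy}$, the $SL(2,\mathbb{C})$ character variety of $H_m$ is $$X(H_m)=\{(X,Z)\in\mathbb{C}^2 \mid f_{\frac{m-1}{2}}(X,Z)=0\}.$$
   Context: Character variety. For a finitely presented group $G$, let $R(G)$ be the set of all homomorphisms $\rho:G\to SL(2,\mathbb{C})$, and for $g\in G$ let $\tau_g:R(G)\to\mathbb{C}$, $\tau_g(\rho)=\mathrm{tr}(\rho(g))$. Choose $\gamma_1,\dots,\gamma_\nu\in G$ such that $\tau_{\gamma_1},\dots,\tau_{\gamma_\nu}$ generate the ring generated by all the functions $\tau_g$, $g\in G$. The $SL(2,\mathbb{C})$ character variety of $G$ is $X(G)=\{(\tau_{\gamma_1}(\rho),\dots,\tau_{\gamma_\nu}(\rho)) \mid \rho\in R(G)\}\subseteq\mathbb{C}^\nu$; it is an affine algebraic set, well defined up to canonical isomorphism. For $G=H_m$ the functions $\tau_x,\tau_y,\tau_{xy}$ are generators, and $\tau_x=\tau_y$ since $x$ and $y$ are conjugate in $H_m$, so one uses the coordinates $X=\tau_x$, $Z=\tau_{xy}$; that is, $X(H_m)=\{(\mathrm{tr}\,\rho(x),\mathrm{tr}\,\rho(xy)) \mid \rho\in R(H_m)\}\subseteq\mathbb{C}^2$. Polynomials. Define $p_0(Z)=1$, $p_1(Z)=Z$, $p_2(Z)=Z^2-2$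 and $p_n(Z)=Zp_{n-1}(Z)-p_{n-2}(Z)$ for all $n\ge 3$ (note the convention $p_0=1$). Let $h(X,Z)=X^2-Z$, $k(X)=X^2-2$, and let $\alpha_l(X,Z)=h(X,Z)$ if $l$ is even and $\alpha_l(X,Z)=k(X)$ if $l$ is odd. For $s\ge 1$ put $$f_s(X,Z)=p_s(Z)\,(h(X,Z)-1)+\sum_{i=1}^{s}(-1)^{i}p_{s-i}(Z)\,\alpha_i(X,Z).$$ *)

theory Defs
  imports "HOL-Analysis.Determinants" "HOL-Algebra.Group"
begin

section \<open>Groups given by a presentation\<close>

text \<open>
  A word is a list of letters, a letter being a generator or the formal inverse of one.
  For a set \<^term>\<open>R\<close> of relations (pairs of words to be identified),
  the presented group on all elements of the type of generators consists of the words modulo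
  the smallest congruence that contains \<^term>\<open>R\<close> and lets adjacent inverse
  letters cancel.
\<close>

datatype 'a letter = Gen 'a | Inv 'a

fun inv_letter :: "'a letter \<Rightarrow> 'a letter" where
  "inv_letter (Gen a) = Inv a"
| "inv_letter (Inv a) = Gen a"

inductive_set pres_cong :: "('a letter list \<times> 'a letter list) set \<Rightarrow>
    ('a letter list \<times> 'a letter list) set"
  for R :: "('a letter list \<times> 'a letter list) set" where
  refl: "(u, u) \<in> pres_cong R"
| sym: "(u, v) \<in> pres_cong R \<Longrightarrow> (v, u) \<in> pres_cong R"
| trans: "(u, v) \<in> pres_cong R \<Longrightarrow> (v, w) \<in> pres_cong R \<Longrightarrow> (u, w) \<in> pres_cong R"
| append: "(u, u') \<in> pres_cong R \<Longrightarrow> (v, v') \<in> pres_cong R \<Longrightarrow> (u @ v, u' @ v') \<in> pres_cong R"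
| cancel: "([l, inv_letter l], []) \<in> pres_cong R"
| relation: "(u, v) \<in> R \<Longrightarrow> (u, v) \<in> pres_cong R"

definition pres_class :: "('a letter list \<times> 'a letter list) set \<Rightarrow> 'a letter list \<Rightarrow>
    'a letter list set" where
  "pres_class R w = pres_cong R `` {w}"

definition presented_group :: "('a letter list \<times> 'a letter list) set \<Rightarrow>
    'a letter list set monoid" where
  "presented_group R =
    \<lparr>carrier = UNIV // pres_cong R,
     mult = (\<lambda>A B. \<Union>u\<in>A. \<Union>v\<in>B. pres_class R (u @ v)),
     one = pres_class R []\<rparr>"

lemma equiv_pres_cong: "equiv UNIV (pres_cong R)"
  by (rule equivI)
    (auto simp: refl_on_def sym_def trans_def intro: pres_cong.refl pres_cong.sym pres_cong.trans)

lemma pres_class_eq_iff: "pres_class R u = pres_class R v \<longleftrightarrow> (u, v) \<in> pres_cong R"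
  unfolding pres_class_def by (simp add: eq_equiv_class_iff[OF equiv_pres_cong])

lemma carrier_presented_group: "carrier (presented_group R) = range (pres_class R)"
  by (auto simp: presented_group_def quotient_def pres_class_def)

lemma mult_presented_group:
  "pres_class R u \<otimes>\<^bsub>presented_group R\<^esub> pres_class R v = pres_class R (u @ v)"
proof -
  have "congruent2 (pres_cong R) (pres_cong R) (\<lambda>u v. pres_class R (u @ v))"
    by (rule congruent2I') (simp add: pres_class_eq_iff pres_cong.append)
  from UN_equiv_class2[OF equiv_pres_cong equiv_pres_cong this, of u v]
  show ?thesis
    by (simp add: presented_group_def pres_class_def)
qed

lemma one_presented_group: "\<one>\<^bsub>presented_group R\<^esub> = pres_class R []"
  by (simp add: presented_group_def)

lemma inverse_word_pres_cong: "(rev (map inv_letter u) @ u, []) \<in> pres_cong R"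
proof (induction u)
  case Nil
  show ?case by (simp add: pres_cong.refl)
next
  case (Cons l u)
  have "inv_letter (inv_letter l) = l"
    by (cases l) simp_all
  then have "([inv_letter l, l], []) \<in> pres_cong R"
    using pres_cong.cancel[of "inv_letter l" R] by simp
  then have "([inv_letter l, l] @ u, [] @ u) \<in> pres_cong R"
    by (intro pres_cong.append pres_cong.refl)
  then have "(rev (map inv_letter u) @ [inv_letter l, l] @ u,
      rev (map inv_letter u) @ [] @ u) \<in> pres_cong R"
    by (intro pres_cong.append[OF pres_cong.refl])
  with Cons.IH show ?case
    by (auto intro: pres_cong.trans)
qed

lemma group_presented_group: "group (presented_group R)"
proof (rule groupI)
  fix g assume "g \<in> carrier (presented_group R)"
  then obtain u where "g = pres_class R u"
    by (auto simp: carrier_presented_group)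
  then have "pres_class R (rev (map inv_letter u)) \<otimes>\<^bsub>presented_group R\<^esub> g
      = \<one>\<^bsub>presented_group R\<^esub>"
    by (simp add: mult_presented_group one_presented_group pres_class_eq_iff
        inverse_word_pres_cong)
  then show "\<exists>h\<in>carrier (presented_group R).
      h \<otimes>\<^bsub>presented_group R\<^esub> g = \<one>\<^bsub>presented_group R\<^esub>"
    by (auto simp: carrier_presented_group)
qed (auto simp: carrier_presented_group mult_presented_group one_presented_group)


section \<open>Representations into the special linear group and their characters\<close>

definition SL2C :: "(complex^2^2) monoid" where
  "SL2C = \<lparr>carrier = {A. det A = 1}, mult = (**), one = mat 1\<rparr>"

lemma group_SL2C: "group SL2C"
proof (rule groupI)
  fix A assume "A \<in> carrier SL2C"
  then have A: "det A = 1"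
    by (simp add: SL2C_def)
  then have "invertible A"
    by (simp add: invertible_det_nz)
  then obtain B where B: "B ** A = mat 1"
    by (auto simp: invertible_def)
  then have "det B = 1"
    using A by (metis det_I det_mul mult.right_neutral)
  with B show "\<exists>B\<in>carrier SL2C. B \<otimes>\<^bsub>SL2C\<^esub> A = \<one>\<^bsub>SL2C\<^esub>"
    by (auto simp: SL2C_def)
qed (auto simp: SL2C_def det_mul matrix_mul_assoc)

definition rep_set :: "('g, 'b) monoid_scheme \<Rightarrow> ('g \<Rightarrow> complex^2^2) set" where
  "rep_set G = hom G SL2C"

definition trace_fun :: "'g \<Rightarrow> ('g \<Rightarrow> complex^2^2) \<Rightarrow> complex" where
  "trace_fun g \<rho> = trace (\<rho> g)"


section \<open>The groups $H_m$ and their character varieties\<close>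

datatype gen = GenX | GenY

fun alt_word :: "'a \<Rightarrow> 'a \<Rightarrow> nat \<Rightarrow> 'a letter list" where
  "alt_word a b 0 = []"
| "alt_word a b (Suc n) = Gen a # alt_word b a n"

definition H_relations :: "nat \<Rightarrow> (gen letter list \<times> gen letter list) set" where
  "H_relations m = {(alt_word GenX GenY m, alt_word GenY GenX m)}"

definition H_group :: "nat \<Rightarrow> gen letter list set monoid" where
  "H_group m = presented_group (H_relations m)"

definition H_x :: "nat \<Rightarrow> gen letter list set" where
  "H_x m = pres_class (H_relations m) [Gen GenX]"

definition H_y :: "nat \<Rightarrow> gen letter list set" where
  "H_y m = pres_class (H_relations m) [Gen GenY]"

text \<open>
  For odd \<^term>\<open>m\<close> the generators are conjugate in \<^term>\<open>H_group m\<close>, so the trace function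
  of the second generator is not needed as a third coordinate.
\<close>

definition character_variety_H :: "nat \<Rightarrow> (complex \<times> complex) set" where
  "character_variety_H m =
    {(trace_fun (H_x m) \<rho>, trace_fun (H_x m \<otimes>\<^bsub>H_group m\<^esub> H_y m) \<rho>) | \<rho>. \<rho> \<in> rep_set (H_group m)}"


section \<open>The defining polynomials\<close>

text \<open>
  The value at index 0 is 1, although the recurrence, which starts at index 3,
  would extend backwards to the value 2.
\<close>

fun p_poly :: "nat \<Rightarrow> complex \<Rightarrow> complex" where
  "p_poly 0 Z = 1"
| "p_poly (Suc 0) Z = Z"
| "p_poly (Suc (Suc 0)) Z = Z\<^sup>2 - 2"
| "p_poly (Suc (Suc (Suc n))) Z = Z * p_poly (Suc (Suc n)) Z - p_poly (Suc n) Z"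

definition h_poly :: "complex \<Rightarrow> complex \<Rightarrow> complex" where
  "h_poly X Z = X\<^sup>2 - Z"

definition k_poly :: "complex \<Rightarrow> complex" where
  "k_poly X = X\<^sup>2 - 2"

definition alpha_poly :: "nat \<Rightarrow> complex \<Rightarrow> complex \<Rightarrow> complex" where
  "alpha_poly l X Z = (if even l then h_poly X Z else k_poly X)"

definition f_poly :: "nat \<Rightarrow> complex \<Rightarrow> complex \<Rightarrow> complex" where
  "f_poly s X Z = p_poly s Z * (h_poly X Z - 1) + (\<Sum>i=1..s. (-1) ^ i * p_poly (s - i) Z * alpha_poly i X Z)"

end

theory Submission
  imports Defs
begin

text \<open>
  Let \<open>m = 2 s + 1\<close> and let \<open>A\<close>, \<open>B\<close> be the images of the generators. They are conjugate by the
  relation, so both have trace \<open>X\<close>. By Cayley--Hamilton for \<open>A B\<close> and \<open>B A\<close>, the difference of the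
  two sides of the relation satisfies the recurrence \<open>D (s + 2) = Z D (s + 1) - D s\<close>, and
  \<open>D 0 = A - B\<close>, \<open>D 1 = (Z - 1) (A - B)\<close>. Hence \<open>D s = q s Z (A - B)\<close> for polynomials
  \<open>q s\<close> with the same recurrence, and the relation means \<open>A = B\<close> or \<open>q s Z = 0\<close>. On the other side
  \<open>f s = (X\<^sup>2 - Z - 2) q s\<close> (for \<open>s \<ge> 1\<close> only, as \<open>f 0 = X\<^sup>2 - Z - 1\<close>), where \<open>Z = X\<^sup>2 - 2\<close> is the locus of \<open>A = B\<close>, and every \<open>(X, Z)\<close> is realised
  by some pair of matrices of trace \<open>X\<close>.
\<close>

section \<open>The universal property of a presented group\<close>

fun eval_letter :: "('g, 'c) monoid_scheme \<Rightarrow> ('a \<Rightarrow> 'g) \<Rightarrow> 'a letter \<Rightarrow> 'g" where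
  "eval_letter G f (Gen a) = f a"
| "eval_letter G f (Inv a) = inv\<^bsub>G\<^esub> (f a)"

fun eval_word :: "('g, 'c) monoid_scheme \<Rightarrow> ('a \<Rightarrow> 'g) \<Rightarrow> 'a letter list \<Rightarrow> 'g" where
  "eval_word G f [] = \<one>\<^bsub>G\<^esub>"
| "eval_word G f (l # w) = eval_letter G f l \<otimes>\<^bsub>G\<^esub> eval_word G f w"

context group
begin

lemma eval_letter_closed: "range f \<subseteq> carrier G \<Longrightarrow> eval_letter G f l \<in> carrier G"
  by (cases l) auto

lemma eval_word_closed: "range f \<subseteq> carrier G \<Longrightarrow> eval_word G f w \<in> carrier G"
  by (induction w) (simp_all add: eval_letter_closed)

lemma eval_word_append:
  "range f \<subseteq> carrier G \<Longrightarrow> eval_word G f (u @ v) = eval_word G f u \<otimes> eval_word G f v"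
  by (induction u) (simp_all add: eval_letter_closed eval_word_closed m_assoc)

lemma eval_word_pres_cong:
  assumes f: "range f \<subseteq> carrier G"
    and R: "\<And>u v. (u, v) \<in> R \<Longrightarrow> eval_word G f u = eval_word G f v"
    and "(u, v) \<in> pres_cong R"
  shows "eval_word G f u = eval_word G f v"
  using assms(3)
proof induction
  case (append u u' v v')
  then show ?case
    by (simp add: eval_word_append[OF f])
next
  case (cancel l)
  have "f a \<in> carrier G" for a
    using f by auto
  then show ?case
    by (cases l) simp_all
qed (simp_all add: R)

text \<open>Existence half of the universal property: evaluation is constant on congruence classes,
  so the representative chosen by \<open>SOME\<close> does not matter.\<close>

lemma presented_group_hom_exists:
  assumes f: "range f \<subseteq> carrier G"
    and R: "\<And>u v. (u, v) \<in> R \<Longrightarrow> eval_word G f u = eval_word G f v"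
  obtains \<rho> where "\<rho> \<in> hom (presented_group R) G"
    and "\<And>w. \<rho> (pres_class R w) = eval_word G f w"
proof -
  define \<rho> where "\<rho> C = eval_word G f (SOME w. pres_class R w = C)" for C
  have \<rho>: "\<rho> (pres_class R w) = eval_word G f w" for w
    unfolding \<rho>_def
    by (rule someI2[of _ w])
      (auto simp: pres_class_eq_iff intro: eval_word_pres_cong[OF f R])
  show thesis
  proof (rule that[OF _ \<rho>], rule homI)
    fix C D
    assume "C \<in> carrier (presented_group R)"
    then obtain u where u: "C = pres_class R u"
      by (auto simp: carrier_presented_group)
    then show "\<rho> C \<in> carrier G"
      by (simp add: \<rho> eval_word_closed[OF f])
    assume "D \<in> carrier (presented_group R)"
    then obtain v where "D = pres_class R v"
      by (auto simp: carrier_presented_group)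
    with u show "\<rho> (C \<otimes>\<^bsub>presented_group R\<^esub> D) = \<rho> C \<otimes> \<rho> D"
      by (simp add: mult_presented_group \<rho> eval_word_append[OF f])
  qed
qed

text \<open>Uniqueness half: the value on \<open>Inv a\<close> is forced by cancellation, and words
  are products of letters.\<close>

lemma presented_group_hom_eq_eval_word:
  assumes \<rho>: "\<rho> \<in> hom (presented_group R) G"
  shows "\<rho> (pres_class R w) = eval_word G (\<lambda>a. \<rho> (pres_class R [Gen a])) w"
proof -
  interpret h: group_hom "presented_group R" G \<rho>
    by (simp add: group_hom_def group_hom_axioms_def group_presented_group is_group \<rho>)
  have in_carrier: "pres_class R u \<in> carrier (presented_group R)" for u
    by (simp add: carrier_presented_group)
  have letter: "\<rho> (pres_class R [l]) = eval_letter G (\<lambda>a. \<rho> (pres_class R [Gen a])) l" for l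
  proof (cases l)
    case (Inv a)
    have "pres_class R [Inv a] \<otimes>\<^bsub>presented_group R\<^esub> pres_class R [Gen a]
        = \<one>\<^bsub>presented_group R\<^esub>"
      using pres_cong.cancel[of "Inv a" R]
      by (simp add: mult_presented_group one_presented_group pres_class_eq_iff)
    then have "pres_class R [Inv a] = inv\<^bsub>presented_group R\<^esub> pres_class R [Gen a]"
      by (metis h.inv_equality in_carrier)
    with Inv show ?thesis
      by (simp add: in_carrier)
  qed simp
  show ?thesis
  proof (induction w)
    case Nil
    show ?case
      using h.hom_one by (simp add: one_presented_group)
  next
    case (Cons l w)
    have "\<rho> (pres_class R (l # w)) = \<rho> (pres_class R [l] \<otimes>\<^bsub>presented_group R\<^esub> pres_class R w)"
      by (simp add: mult_presented_group)
    also have "\<dots> = \<rho> (pres_class R [l]) \<otimes> \<rho> (pres_class R w)"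
      by (simp add: in_carrier)
    finally show ?case
      by (simp only: letter[of l] Cons.IH eval_word.simps)
  qed
qed

end

section \<open>Alternating products of two matrices\<close>

fun alt_prod :: "complex^2^2 \<Rightarrow> complex^2^2 \<Rightarrow> nat \<Rightarrow> complex^2^2" where
  "alt_prod A B 0 = mat 1"
| "alt_prod A B (Suc n) = A ** alt_prod B A n"

lemma eval_word_alt_word: "eval_word SL2C f (alt_word a b n) = alt_prod (f a) (f b) n"
  by (induction n arbitrary: a b) (simp_all add: SL2C_def)

lemma det_alt_prod: "det A = 1 \<Longrightarrow> det B = 1 \<Longrightarrow> det (alt_prod A B n) = 1"
  by (induction n arbitrary: A B) (simp_all add: det_mul)

text \<open>Turns the odd relation into a conjugation \<open>W ** A = B ** W\<close>, where
  \<open>W\<close> is the product of even length.\<close>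

lemma alt_prod_odd: "alt_prod A B (Suc (2 * n)) = alt_prod A B (2 * n) ** A"
  by (induction n) (simp_all add: matrix_mul_assoc[symmetric])

text \<open>The characteristic equation of \<open>M\<close>, applied to the columns of
  \<open>N\<close>; hence only the row index is split.\<close>

lemma cayley_hamilton_2:
  fixes M N :: "complex^2^2"
  assumes "det M = 1"
  shows "(M ** (M ** N)) $ i $ j = trace M * (M ** N) $ i $ j - N $ i $ j"
proof -
  have "(M ** (M ** N)) $ i $ j - trace M * (M ** N) $ i $ j = - (det M * N $ i $ j)"
    using exhaust_2[of i] by (auto simp: matrix_matrix_mult_def sum_2 trace_def det_2 algebra_simps)
  then show ?thesis
    by (simp add: assms algebra_simps)
qed

text \<open>The four leading factors form the square of \<open>A ** B\<close>, which has determinant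
  1.\<close>

lemma alt_prod_rec:
  assumes "det A = 1" "det B = 1"
  shows "alt_prod A B (n + 4) $ i $ j
    = trace (A ** B) * alt_prod A B (n + 2) $ i $ j - alt_prod A B n $ i $ j"
  using cayley_hamilton_2[of "A ** B" "alt_prod A B n" i j] assms
  by (simp add: det_mul matrix_mul_assoc numeral_eq_Suc)

text \<open>Chebyshev polynomials of the third kind in Z/2: for Z = 2 cos t, the n-th is cos((n +
  1/2) t) / cos(t/2).\<close>

fun q_poly :: "nat \<Rightarrow> complex \<Rightarrow> complex" where
  "q_poly 0 Z = 1"
| "q_poly (Suc 0) Z = Z - 1"
| "q_poly (Suc (Suc n)) Z = Z * q_poly (Suc n) Z - q_poly n Z"

text \<open>Since A B = tr(A B) I - adj(B) adj(A) and adj(A) A = det(A) I, multiplying by A on the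
  right leaves det(A) adj(B), with adj(B) = tr(B) I - B.\<close>

lemma braid_product_2:
  fixes A B :: "complex^2^2"
  shows "(A ** (B ** A)) $ i $ j
    = trace (A ** B) * A $ i $ j - det A * (trace B * mat 1 $ i $ j - B $ i $ j)"
  using exhaust_2[of i] exhaust_2[of j]
  by (auto simp: matrix_matrix_mult_def sum_2 trace_def det_2 mat_def algebra_simps)

text \<open>Equal traces make the multiples of the identity cancel; this is the initial value
  \<open>q_poly 1\<close>.\<close>

lemma braid_difference:
  fixes A B :: "complex^2^2"
  assumes "det A = 1" "det B = 1" "trace A = trace B"
  shows "(A ** (B ** A)) $ i $ j - (B ** (A ** B)) $ i $ j
    = (trace (A ** B) - 1) * (A $ i $ j - B $ i $ j)"
  by (simp add: braid_product_2 assms trace_mul_sym[of B A] algebra_simps)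

lemma alt_prod_difference:
  assumes "det A = 1" "det B = 1" "trace A = trace B"
  shows "alt_prod A B (Suc (2 * n)) $ i $ j - alt_prod B A (Suc (2 * n)) $ i $ j
    = q_poly n (trace (A ** B)) * (A $ i $ j - B $ i $ j)"
proof (induction n "trace (A ** B)" rule: q_poly.induct)
  case 2
  show ?case
    using braid_difference[OF assms, of i j] by (simp add: numeral_eq_Suc)
next
  case (3 n)
  let ?D = "\<lambda>k. alt_prod A B k $ i $ j - alt_prod B A k $ i $ j"
  \<comment> \<open>Both products obey the same recurrence, as \<open>A ** B\<close> and
    \<open>B ** A\<close> have the same trace.\<close>
  have rec: "?D (k + 4) = trace (A ** B) * ?D (k + 2) - ?D k" for k
    by (simp only: alt_prod_rec assms trace_mul_sym[of B A]) (simp only: algebra_simps)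
  have "?D (Suc (2 * Suc (Suc n))) = trace (A ** B) * ?D (Suc (2 * Suc n)) - ?D (Suc (2 * n))"
    using rec[of "Suc (2 * n)"] by (simp add: numeral_eq_Suc del: alt_prod.simps)
  then show ?case
    by (simp only: 3 q_poly.simps) (simp only: algebra_simps)
qed simp

lemma alt_prod_odd_eq_iff:
  assumes "det A = 1" "det B = 1" "trace A = trace B"
  shows "alt_prod A B (Suc (2 * n)) = alt_prod B A (Suc (2 * n))
    \<longleftrightarrow> A = B \<or> q_poly n (trace (A ** B)) = 0"
proof -
  have "alt_prod A B (Suc (2 * n)) = alt_prod B A (Suc (2 * n))
      \<longleftrightarrow> (\<forall>i j. q_poly n (trace (A ** B)) * (A $ i $ j - B $ i $ j) = 0)"
    by (simp only: alt_prod_difference[OF assms, symmetric] vec_eq_iff right_minus_eq)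
  then show ?thesis
    by (auto simp: vec_eq_iff)
qed

lemma trace_eq_of_alt_prod_odd_eq:
  assumes "det A = 1" "det B = 1"
    and eq: "alt_prod A B (Suc (2 * n)) = alt_prod B A (Suc (2 * n))"
  shows "trace A = trace B"
proof -
  let ?W = "alt_prod A B (2 * n)"
  have "invertible ?W"
    by (simp add: invertible_det_nz det_alt_prod assms)
  then obtain V where V: "?W ** V = mat 1" "V ** ?W = mat 1"
    by (auto simp: invertible_def)
  have conj: "?W ** A = B ** ?W"
    using eq by (metis alt_prod.simps(2) alt_prod_odd)
  have "trace A = trace (V ** (?W ** A))"
    by (simp add: matrix_mul_assoc V)
  also have "\<dots> = trace (?W ** A ** V)"
    by (rule trace_mul_sym)
  also have "\<dots> = trace B"
    by (simp add: conj matrix_mul_assoc[symmetric] V)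
  finally show ?thesis .
qed

lemma exists_SL2_pair_with_traces:
  obtains A B :: "complex^2^2"
  where "det A = 1" "det B = 1" "trace A = X" "trace B = X" "trace (A ** B) = Z"
proof -
  \<comment> \<open>A root of u^2 - Z u + 1 = 0, so that \<open>Z - u\<close> is its inverse. Then
    \<open>B\<close> below has determinant u (Z - u) = 1, and \<open>A ** B\<close> is upper
    triangular with diagonal \<open>Z - u\<close>, \<open>u\<close>.\<close>
  define u where "u = (Z + csqrt (Z\<^sup>2 - 4)) / 2"
  have "(csqrt (Z\<^sup>2 - 4))\<^sup>2 = Z\<^sup>2 - 4"
    by simp
  then have u: "u * (Z - u) = 1"
    by (simp add: u_def field_simps power2_eq_square)
  define A :: "complex^2^2" where "A = vector [vector [X, -1], vector [1, 0]]"
  define B :: "complex^2^2" where "B = vector [vector [0, u], vector [u - Z, X]]"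
  show thesis
    by (rule that[of A B])
      (use u in \<open>simp_all add: A_def B_def det_2 trace_def sum_2 matrix_matrix_mult_def algebra_simps\<close>)
qed

lemma exists_SL2_with_trace:
  obtains A :: "complex^2^2" where "det A = 1" "trace A = X"
  using exists_SL2_pair_with_traces by metis

lemma trace_square_SL2:
  fixes A :: "complex^2^2"
  assumes "det A = 1"
  shows "trace (A ** A) = (trace A)\<^sup>2 - 2"
proof -
  have "trace (A ** A) = (trace A)\<^sup>2 - 2 * det A"
    by (simp add: trace_def sum_2 matrix_matrix_mult_def det_2 power2_eq_square algebra_simps)
  then show ?thesis
    using assms by simp
qed

section \<open>Factorisation of the defining polynomial\<close>

text \<open>Both sides satisfy the same recurrence in \<open>n\<close>. The indices of
  \<open>p_poly\<close> start at 1, which keeps clear of the exceptional value at index 0.\<close>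

lemma q_poly_diff: "q_poly (Suc (Suc n)) Z - q_poly n Z = p_poly (Suc (Suc n)) Z - p_poly (Suc n) Z"
proof (induction n Z rule: q_poly.induct)
  case (3 n Z)
  have "q_poly (Suc (Suc (Suc (Suc n)))) Z - q_poly (Suc (Suc n)) Z
      = Z * (q_poly (Suc (Suc (Suc n))) Z - q_poly (Suc n) Z)
        - (q_poly (Suc (Suc n)) Z - q_poly n Z)"
    by (simp add: algebra_simps)
  also have "\<dots> = Z * (p_poly (Suc (Suc (Suc n))) Z - p_poly (Suc (Suc n)) Z)
        - (p_poly (Suc (Suc n)) Z - p_poly (Suc n) Z)"
    by (simp only: 3)
  also have "\<dots> = p_poly (Suc (Suc (Suc (Suc n)))) Z - p_poly (Suc (Suc (Suc n))) Z"
    by (simp add: algebra_simps)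
  finally show ?case .
qed (simp_all add: power2_eq_square algebra_simps)

text \<open>Signs and \<open>alpha_poly\<close> have period 2, so the terms from
  \<open>i = 3\<close> on form the sum in \<open>f_poly n\<close>. The term \<open>i = 2\<close> is
  \<open>p_poly n Z * h_poly X Z\<close>, which supplies the leading term of \<open>f_poly n\<close>
  and one extra \<open>p_poly n Z\<close>.\<close>

lemma f_poly_rec:
  "f_poly (Suc (Suc n)) X Z = p_poly (Suc (Suc n)) Z * (h_poly X Z - 1)
     - p_poly (Suc n) Z * k_poly X + p_poly n Z + f_poly n X Z"
proof -
  let ?t = "\<lambda>i. (-1) ^ i * p_poly (Suc (Suc n) - i) Z * alpha_poly i X Z"
  have "(\<Sum>i=1..Suc (Suc n). ?t i) = ?t 1 + ?t 2 + (\<Sum>i=3..Suc (Suc n). ?t i)"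
    using sum.atLeast_Suc_atMost[of 1 "Suc (Suc n)" ?t] sum.atLeast_Suc_atMost[of 2 "Suc (Suc n)" ?t]
    by (simp add: numeral_eq_Suc)
  also have "(\<Sum>i=3..Suc (Suc n). ?t i) = (\<Sum>i=1..n. ?t (i + 2))"
    using sum.shift_bounds_cl_nat_ivl[of ?t 1 2 n] by (simp add: numeral_eq_Suc)
  also have "\<dots> = (\<Sum>i=1..n. (-1) ^ i * p_poly (n - i) Z * alpha_poly i X Z)"
    by (rule sum.cong) (simp_all add: alpha_poly_def)
  finally show ?thesis
    by (simp add: f_poly_def alpha_poly_def[of "Suc 0"] alpha_poly_def[of 2] algebra_simps)
qed

lemma f_poly_Suc_factor: "f_poly (Suc n) X Z = (X\<^sup>2 - Z - 2) * q_poly (Suc n) Z"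
proof (induction n Z rule: q_poly.induct)
  case (3 n Z)
  \<comment> \<open>Replacing \<open>p_poly (Suc n) Z\<close> by means of its recurrence gives the
    coefficients h - 2 and -(k - Z), and h - 2 = k - Z = X^2 - Z - 2.\<close>
  have "f_poly (Suc (Suc (Suc n))) X Z
      = (X\<^sup>2 - Z - 2) * (p_poly (Suc (Suc (Suc n))) Z - p_poly (Suc (Suc n)) Z) + f_poly (Suc n) X Z"
    by (simp add: f_poly_rec h_poly_def k_poly_def power2_eq_square algebra_simps)
  also have "\<dots> = (X\<^sup>2 - Z - 2) * q_poly (Suc (Suc (Suc n))) Z"
    by (simp only: q_poly_diff[symmetric] 3) (simp only: algebra_simps)
  finally show ?case .
qed (simp_all add: f_poly_def h_poly_def k_poly_def alpha_poly_def power2_eq_square algebra_simps)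

section \<open>The character variety\<close>

text \<open>By the universal property, representations correspond to pairs of matrices that satisfy
  the relation.\<close>

lemma character_variety_H_eq_alt_prod:
  "character_variety_H m = {(trace A, trace (A ** B)) | A B.
     det A = 1 \<and> det B = 1 \<and> alt_prod A B m = alt_prod B A m}"
proof (intro equalityI subsetI)
  interpret SL2C: group SL2C
    by (rule group_SL2C)
  fix P
  assume "P \<in> character_variety_H m"
  then obtain \<rho> where \<rho>: "\<rho> \<in> hom (presented_group (H_relations m)) SL2C"
    and P: "P = (trace (\<rho> (H_x m)), trace (\<rho> (H_x m \<otimes>\<^bsub>H_group m\<^esub> H_y m)))"
    by (auto simp: character_variety_H_def rep_set_def trace_fun_def H_group_def)
  let ?f = "\<lambda>a. \<rho> (pres_class (H_relations m) [Gen a])"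
  note eval = SL2C.presented_group_hom_eq_eval_word[OF \<rho>]
  have det: "det (?f a) = 1" for a
    using hom_in_carrier[OF \<rho>, of "pres_class (H_relations m) [Gen a]"]
    by (simp add: SL2C_def carrier_presented_group)
  have "pres_class (H_relations m) (alt_word GenX GenY m)
      = pres_class (H_relations m) (alt_word GenY GenX m)"
    by (simp add: pres_class_eq_iff pres_cong.relation H_relations_def)
  then have "eval_word SL2C ?f (alt_word GenX GenY m) = eval_word SL2C ?f (alt_word GenY GenX m)"
    by (metis eval)
  then have "alt_prod (?f GenX) (?f GenY) m = alt_prod (?f GenY) (?f GenX) m"
    by (simp only: eval_word_alt_word)
  moreover have "P = (trace (?f GenX), trace (?f GenX ** ?f GenY))"
    using hom_mult[OF \<rho>, of "H_x m" "H_y m"]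
    by (simp add: P H_group_def H_x_def H_y_def carrier_presented_group SL2C_def)
  ultimately show "P \<in> {(trace A, trace (A ** B)) | A B.
      det A = 1 \<and> det B = 1 \<and> alt_prod A B m = alt_prod B A m}"
    using det by blast
next
  interpret SL2C: group SL2C
    by (rule group_SL2C)
  fix P
  assume "P \<in> {(trace A, trace (A ** B)) | A B.
      det A = 1 \<and> det B = 1 \<and> alt_prod A B m = alt_prod B A m}"
  then obtain A B where P: "P = (trace A, trace (A ** B))" and det: "det A = 1" "det B = 1"
    and rel: "alt_prod A B m = alt_prod B A m"
    by blast
  have gens: "range (case_gen A B) \<subseteq> carrier SL2C"
    using det by (auto simp: SL2C_def split: gen.split)
  have "eval_word SL2C (case_gen A B) u = eval_word SL2C (case_gen A B) v"
    if "(u, v) \<in> H_relations m" for u v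
    using that by (auto simp: H_relations_def eval_word_alt_word rel)
  then obtain \<rho> where \<rho>: "\<rho> \<in> hom (presented_group (H_relations m)) SL2C"
    and eval: "\<And>w. \<rho> (pres_class (H_relations m) w) = eval_word SL2C (case_gen A B) w"
    using SL2C.presented_group_hom_exists[OF gens] by blast
  have "P = (trace (\<rho> (H_x m)), trace (\<rho> (H_x m \<otimes>\<^bsub>H_group m\<^esub> H_y m)))"
    by (simp add: P H_x_def H_y_def H_group_def mult_presented_group eval SL2C_def)
  with \<rho> show "P \<in> character_variety_H m"
    by (auto simp: character_variety_H_def rep_set_def trace_fun_def H_group_def)
qed

theorem proposition4p1:
  fixes m :: nat
  assumes "m > 1" and "odd m"
  shows "character_variety_H m = {(X, Z). f_poly ((m - 1) div 2) X Z = 0}"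
proof -
  obtain s where m: "m = Suc (2 * s)"
    using \<open>odd m\<close> by (auto elim: oddE)
  \<comment> \<open>Here \<open>s\<close> is positive, as the factorisation requires.\<close>
  with \<open>m > 1\<close> have f: "f_poly s X Z = (X\<^sup>2 - Z - 2) * q_poly s Z" for X Z
    using f_poly_Suc_factor[of "s - 1"] by simp
  have "(X, Z) \<in> character_variety_H m \<longleftrightarrow> f_poly s X Z = 0" for X Z
  proof
    assume "(X, Z) \<in> character_variety_H m"
    then obtain A B :: "complex^2^2" where XZ: "X = trace A" "Z = trace (A ** B)"
      and det: "det A = 1" "det B = 1"
      and rel: "alt_prod A B (Suc (2 * s)) = alt_prod B A (Suc (2 * s))"
      by (auto simp: character_variety_H_eq_alt_prod m simp del: alt_prod.simps)
    have "A = B \<or> q_poly s Z = 0"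
      using rel alt_prod_odd_eq_iff[OF det trace_eq_of_alt_prod_odd_eq[OF det rel]] XZ by simp
    \<comment> \<open>If \<open>A = B\<close>, then Z is the trace of a square, X^2 - 2, and the
      first factor vanishes.\<close>
    then show "f_poly s X Z = 0"
      using trace_square_SL2[OF det(1)] by (auto simp: f XZ)
  next
    assume "f_poly s X Z = 0"
    then consider "X\<^sup>2 - Z = 2" | "q_poly s Z = 0"
      by (auto simp: f)
    then obtain A B :: "complex^2^2" where det: "det A = 1" "det B = 1"
      and tr: "trace A = X" "trace B = X" "trace (A ** B) = Z" and "A = B \<or> q_poly s Z = 0"
    proof cases
      \<comment> \<open>Take \<open>A = B\<close> with trace X; in the other case any pair with the
        prescribed traces satisfies the relation.\<close>
      case 1
      then have "Z = X\<^sup>2 - 2"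
        by (simp add: algebra_simps)
      then show ?thesis
        using that exists_SL2_with_trace trace_square_SL2 by metis
    next
      case 2
      then show ?thesis
        using that exists_SL2_pair_with_traces by metis
    qed
    then have "alt_prod A B m = alt_prod B A m"
      unfolding m using alt_prod_odd_eq_iff[OF det, of s] tr by (simp del: alt_prod.simps)
    with det tr show "(X, Z) \<in> character_variety_H m"
      unfolding character_variety_H_eq_alt_prod by blast
  qed
  then show ?thesis
    by (auto simp: m)
qed

end
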